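(* Fix arbitrary $0<\epsilon<1$, and for each integer $K$ let $\beta=\frac{\ln K}{K}$, $\eta=\left(\frac{\ln K}{K}\right)^2$ and $m=\left\lceil\frac{\epsilon^2K}{\ln K}\right\rceil$. Then there exists $K_0=K_0(\epsilon)$ such that for all $K\ge K_0$ and all $d\ge(1+\epsilon)2^{K-1}\ln^2K/K$, $$\lim_{n\to\infty}\mathbb{P}\big(\mathbb{SAT}(\mathbf{\Phi}(n,dn);\beta,\eta,m)=\emptyset\big)=1.$$
   Context: NAE-$K$-SAT. An instance $\Phi$ consists of Boolean variables $x_1,\dots,x_n$ and a finite list of clauses, each consisting of $K$ literals (a literal is a variable $x$ or its negation $\bar x$). An assignment $\sigma:\{x_1,\dots,x_n\}\to\{0,1\}$ satisfies $\Phi$ if every clause has at least one literal with value $1$ and at least one literal with value $0$. Random formula. $\mathbf{\Phi}(n,dn)$ has variables $x_1,\dots,x_n$ and $\lfloor dn\rfloor$ independent clauses; the $K$ variables of each clause are chosen uniformly at random without replacement from $x_1,\dots,x_n$, and each is negated with probability $1/2$, independently over all variables in the clause and over all clauses. $K$ and $d$ do not depend on $n$. $\rho(\sigma^1,\sigma^2)$ denotes the Hamming distance, i.e. the number of variables on which the assignments $\sigma^1,\sigma^2$ differ. For $\beta,\eta\in[0,1]$ and a positive integer $m$, $\mathbb{SAT}(\Phi;\beta,\eta,m)$ is the set of all $m$-tuples $(\sigma^1,\dots,\sigma^m)$ of assignments such that (a) every $\sigma^j$, $1\le j\le m$, satisfies $\Phi$, and (b) for all $j\ne k$, $(\beta-\eta)n\le\rho(\sigma^j,\sigma^k)\le\beta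 n$. *)

theory Defs
  imports "HOL-Probability.Probability"
begin

text \<open>The Boolean variables $x_1,\dots,x_n$ are represented by their indices \<^term>\<open>{1..n}\<close>.\<close>

datatype literal = Pos nat | Neg nat

type_synonym clause = "literal list"
type_synonym formula = "clause list"
type_synonym assignment = "nat \<Rightarrow> bool"

definition assignments :: "nat \<Rightarrow> assignment set" where
  "assignments n = {1..n} \<rightarrow>\<^sub>E UNIV"

fun lit_value :: "assignment \<Rightarrow> literal \<Rightarrow> bool" where
  "lit_value \<sigma> (Pos i) = \<sigma> i"
| "lit_value \<sigma> (Neg i) = (\<not> \<sigma> i)"

definition nae_satisfies :: "assignment \<Rightarrow> formula \<Rightarrow> bool" where
  "nae_satisfies \<sigma> \<Phi> \<longleftrightarrow>
    (\<forall>C\<in>set \<Phi>. (\<exists>l\<in>set C. lit_value \<sigma> l) \<and> (\<exists>l\<in>set C. \<not> lit_value \<sigma> l))"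

definition hamming :: "nat \<Rightarrow> assignment \<Rightarrow> assignment \<Rightarrow> nat" where
  "hamming n \<sigma> \<tau> = card {i \<in> {1..n}. \<sigma> i \<noteq> \<tau> i}"

text \<open>An $m$-tuple of assignments is a list of length $m$, so its components are numbered from 0.\<close>

definition SAT_tuples :: "nat \<Rightarrow> formula \<Rightarrow> real \<Rightarrow> real \<Rightarrow> nat \<Rightarrow> assignment list set" where
  "SAT_tuples n \<Phi> \<beta> \<eta> m =
    {\<sigma>s. length \<sigma>s = m \<and> set \<sigma>s \<subseteq> assignments n \<and>
      (\<forall>j<m. nae_satisfies (\<sigma>s ! j) \<Phi>) \<and>
      (\<forall>j<m. \<forall>k<m. j \<noteq> k \<longrightarrow>
        (\<beta> - \<eta>) * real n \<le> real (hamming n (\<sigma>s ! j) (\<sigma>s ! k)) \<and>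
        real (hamming n (\<sigma>s ! j) (\<sigma>s ! k)) \<le> \<beta> * real n)}"

text \<open>Sampling without replacement is a uniform choice among the repetition-free sequences of
  $K$ variables. For $n < K$ there are none and the distribution is unspecified; this does not
  affect limits as $n \to \infty$.\<close>

definition random_vars :: "nat \<Rightarrow> nat \<Rightarrow> nat list pmf" where
  "random_vars K n = pmf_of_set {xs. length xs = K \<and> distinct xs \<and> set xs \<subseteq> {1..n}}"

definition random_clause :: "nat \<Rightarrow> nat \<Rightarrow> clause pmf" where
  "random_clause K n =
    map_pmf (\<lambda>(xs, negs). map2 (\<lambda>x neg. if neg then Neg x else Pos x) xs negs)
      (pair_pmf (random_vars K n) (replicate_pmf K (bernoulli_pmf (1/2))))"

definition random_formula :: "nat \<Rightarrow> nat \<Rightarrow> real \<Rightarrow> formula pmf" where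
  "random_formula K n d = replicate_pmf (nat \<lfloor>d * real n\<rfloor>) (random_clause K n)"

end

theory Submission
  imports Defs "HOL-Real_Asymp.Real_Asymp"
begin

text \<open>
  First moment method. A tuple with pairwise distances at most $\beta n$ is given by its first
  component and $m-1$ points of a Hamming ball, so there are at most
  $\exp(n(\ln 2 + (m-1)(\beta - \beta\ln\beta)))$ of them, and
  $(m-1)(\beta-\beta\ln\beta) \le \epsilon^2 \ln K$.
  Each component violates a random clause with probability $2^{1-K}$, and two components at
  distance at least $(\beta-\eta)n$ violate it simultaneously with probability at most
  $2^{1-K}q$, where $q = (1-\beta+\eta)^K+\beta^K \approx 1/K$. As $mq \to 0$,
  inclusion-exclusion shows that the $m$ violation events are nearly disjoint, so that all
  $\lfloor dn\rfloor$ clauses are satisfied by the whole tuple with probability about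
  $\exp(-2^{1-K} m d n) \le \exp(-(1+\epsilon)\epsilon^2 n\ln K)$, which beats the number of tuples.
\<close>

section \<open>Probabilities of composed and repeated experiments\<close>

lemma prob_bind_pmf:
  "measure_pmf.prob (bind_pmf p f) A = measure_pmf.expectation p (\<lambda>x. measure_pmf.prob (f x) A)"
proof -
  have "ennreal (measure_pmf.prob (bind_pmf p f) A) = emeasure (measure_pmf (bind_pmf p f)) A"
    by (simp only: measure_pmf.emeasure_eq_measure)
  also have "\<dots> = (\<integral>\<^sup>+x. ennreal (measure_pmf.prob (f x) A) \<partial>measure_pmf p)"
    by (subst emeasure_bind_pmf) (simp only: measure_pmf.emeasure_eq_measure)
  also have "\<dots> = ennreal (measure_pmf.expectation p (\<lambda>x. measure_pmf.prob (f x) A))"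
    by (intro nn_integral_eq_integral measure_pmf.integrable_const_bound[where B=1]) auto
  finally show ?thesis
    by (simp add: integral_nonneg_AE)
qed

lemma prob_replicate_pmf_all:
  "measure_pmf.prob (replicate_pmf k p) {xs. \<forall>x\<in>set xs. P x} = measure_pmf.prob p {x. P x} ^ k"
proof (induction k)
  case 0
  then show ?case by (simp add: measure_return_pmf)
next
  case (Suc k)
  have "measure_pmf.prob (bind_pmf (replicate_pmf k p) (\<lambda>xs. return_pmf (x # xs)))
          {xs. \<forall>x\<in>set xs. P x} = measure_pmf.prob p {x. P x} ^ k * indicator {x. P x} x" for x
    using Suc
    by (auto simp: map_pmf_def[symmetric] indicator_def vimage_def)
  then show ?case
    by (simp add: prob_bind_pmf)
qed

lemma pmf_replicate_pmf_bernoulli_half: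
  "pmf (replicate_pmf k (bernoulli_pmf (1/2))) bs = (if length bs = k then (1/2) ^ k else 0)"
proof (induction k arbitrary: bs)
  case 0
  then show ?case by (auto simp: pmf_return)
next
  case (Suc k)
  \<comment> \<open>The condition \<open>bs = x # tl bs\<close> also fails for
    \<open>bs = []\<close>, so this claim treats the empty list without a case of its own.\<close>
  have "pmf (bind_pmf (replicate_pmf k (bernoulli_pmf (1/2))) (\<lambda>ys. return_pmf (x # ys))) bs =
      (if bs = x # tl bs then pmf (replicate_pmf k (bernoulli_pmf (1/2))) (tl bs) else 0)" for x
  proof (cases "bs = x # tl bs")
    case True
    then obtain ys where "bs = x # ys" by metis
    then show ?thesis
      by (simp add: map_pmf_def[symmetric] pmf_map_inj')
  next
    case False
    then show ?thesis
      by (auto simp: map_pmf_def[symmetric] pmf_eq_0_set_pmf)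
  qed
  note * = this
  show ?case
    unfolding replicate_pmf.simps pmf_bind[of "bernoulli_pmf _"] *
    by (cases bs) (auto simp: Suc integral_bernoulli_pmf)
qed

section \<open>Random signs on fixed variables\<close>

definition literals :: "nat list \<Rightarrow> bool list \<Rightarrow> clause" where
  "literals = map2 (\<lambda>x neg. if neg then Neg x else Pos x)"

text \<open>Separates the two sources of randomness: later bounds fix the variables, use only the
  signs, and then average over the variables.\<close>

lemma random_clause_eq_bind:
  "random_clause K n =
    bind_pmf (random_vars K n)
      (\<lambda>xs. map_pmf (literals xs) (replicate_pmf K (bernoulli_pmf (1/2))))"
  unfolding random_clause_def pair_pmf_def literals_def
  by (simp add: map_pmf_def bind_assoc_pmf bind_return_pmf)

text \<open>A literal is false exactly when its negation bit equals the value of its variable. Hence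
  all literals are false for one sign vector only, and all are true for its complement only.\<close>

lemma nae_satisfies_singleton_iff:
  assumes "length bs = length xs"
  shows "nae_satisfies \<sigma> [literals xs bs] \<longleftrightarrow> bs \<notin> {map \<sigma> xs, map (Not \<circ> \<sigma>) xs}"
proof -
  have "(\<exists>l\<in>set (literals xs bs). lit_value \<sigma> l) \<longleftrightarrow> bs \<noteq> map \<sigma> xs"
    using assms by (induction bs xs rule: list_induct2) (auto simp: literals_def)
  moreover have "(\<exists>l\<in>set (literals xs bs). \<not> lit_value \<sigma> l) \<longleftrightarrow> bs \<noteq> map (Not \<circ> \<sigma>) xs"
    using assms by (induction bs xs rule: list_induct2) (auto simp: literals_def)
  ultimately show ?thesis
    by (auto simp: nae_satisfies_def)
qed

lemma prob_signs_violate: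
  assumes "K \<ge> 1" "length xs = K"
  shows "measure_pmf.prob (map_pmf (literals xs) (replicate_pmf K (bernoulli_pmf (1/2))))
    {C. \<not> nae_satisfies \<sigma> [C]} = 2 * (1/2) ^ K"
proof -
  let ?p = "replicate_pmf K (bernoulli_pmf (1/2))"
  have len: "length bs = length xs" if "bs \<in> set_pmf ?p" for bs
    using that assms by (simp add: set_replicate_pmf)
  have "measure_pmf.prob (map_pmf (literals xs) ?p) {C. \<not> nae_satisfies \<sigma> [C]} =
      measure_pmf.prob ?p {map \<sigma> xs, map (Not \<circ> \<sigma>) xs}"
    unfolding measure_map_pmf
    by (rule measure_eq_AE) (auto intro!: AE_pmfI simp: nae_satisfies_singleton_iff len)
  also have "\<dots> = 2 * (1/2) ^ K"
  proof -
    \<comment> \<open>\<open>xs\<close> is nonempty because K \<ge> 1, so the two violating sign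
      vectors are distinct and give the factor 2.\<close>
    have "map \<sigma> xs \<noteq> map (Not \<circ> \<sigma>) xs"
      using assms by (cases xs) auto
    then show ?thesis
      using assms
      by (simp add: measure_measure_pmf_finite pmf_replicate_pmf_bernoulli_half)
  qed
  finally show ?thesis .
qed

text \<open>For each assignment the violating sign vectors form a complementary pair. The pairs of
  \<sigma> and \<tau> coincide if the assignments agree on all of \<open>xs\<close> or differ on all
  of \<open>xs\<close>; otherwise they are disjoint.\<close>

lemma prob_signs_violate_both:
  assumes "K \<ge> 1" "length xs = K"
  shows "measure_pmf.prob (map_pmf (literals xs) (replicate_pmf K (bernoulli_pmf (1/2))))
      {C. \<not> nae_satisfies \<sigma> [C] \<and> \<not> nae_satisfies \<tau> [C]}
    \<le> 2 * (1/2) ^ K * (indicator {xs. set xs \<subseteq> {i. \<sigma> i = \<tau> i}} xs +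
                       indicator {xs. set xs \<subseteq> {i. \<sigma> i \<noteq> \<tau> i}} xs)"
proof -
  let ?p = "replicate_pmf K (bernoulli_pmf (1/2))"
  let ?q = "map_pmf (literals xs) ?p"
  have len: "length bs = length xs" if "bs \<in> set_pmf ?p" for bs
    using that assms by (simp add: set_replicate_pmf)
  show ?thesis
  proof (cases "set xs \<subseteq> {i. \<sigma> i = \<tau> i} \<or> set xs \<subseteq> {i. \<sigma> i \<noteq> \<tau> i}")
    case True
    have "measure_pmf.prob ?q {C. \<not> nae_satisfies \<sigma> [C] \<and> \<not> nae_satisfies \<tau> [C]}
        \<le> measure_pmf.prob ?q {C. \<not> nae_satisfies \<sigma> [C]}"
      by (intro measure_pmf.finite_measure_mono) auto
    also have "\<dots> = 2 * (1/2) ^ K"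
      by (rule prob_signs_violate[OF assms])
    also have "\<dots> \<le> 2 * (1/2) ^ K * (indicator {xs. set xs \<subseteq> {i. \<sigma> i = \<tau> i}} xs +
        indicator {xs. set xs \<subseteq> {i. \<sigma> i \<noteq> \<tau> i}} xs)"
      using True by (auto simp: indicator_def)
    finally show ?thesis .
  next
    case False
    then have "{map \<sigma> xs, map (Not \<circ> \<sigma>) xs} \<inter> {map \<tau> xs, map (Not \<circ> \<tau>) xs} = {}"
      by auto
    then have "measure_pmf.prob ?q {C. \<not> nae_satisfies \<sigma> [C] \<and> \<not> nae_satisfies \<tau> [C]} =
        measure_pmf.prob ?p {}"
      unfolding measure_map_pmf
      by (intro measure_eq_AE AE_pmfI)
         (simp_all add: nae_satisfies_singleton_iff len del: insert_iff, blast)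
    then show ?thesis by simp
  qed
qed

section \<open>Sampling variables without replacement\<close>

lemma finite_distinct_lists:
  "finite A \<Longrightarrow> finite {xs. length xs = k \<and> distinct xs \<and> set xs \<subseteq> A}"
  by (rule finite_subset[OF _ finite_lists_length_eq[of A k]]) auto

text \<open>Truncated subtraction keeps the falling factorial correct for \<open>k > card A\<close>:
  the factor with \<open>i = card A\<close> vanishes. This covers sets with fewer than K elements in
  \<open>prob_random_vars_subset\<close>.\<close>

lemma card_distinct_lists_eq_prod:
  assumes "finite A"
  shows "card {xs. length xs = k \<and> distinct xs \<and> set xs \<subseteq> A} = (\<Prod>i<k. card A - i)"
proof (cases "k \<le> card A")
  case True
  have "(\<Prod>i<k. card A - i) = \<Prod>{card A - k + 1..card A}"
    using True
    by (intro prod.reindex_bij_witness[of _ "\<lambda>i. card A - i" "\<lambda>i. card A - i"]) auto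
  then show ?thesis
    using card_lists_distinct_length_eq[OF assms True] by simp
next
  case False
  then have "{xs. length xs = k \<and> distinct xs \<and> set xs \<subseteq> A} = {}"
    using card_mono[OF assms] by (auto simp: distinct_card[symmetric])
  moreover have "(\<Prod>i<k. card A - i) = 0"
    using False by (auto intro!: bexI[of _ "card A"])
  ultimately show ?thesis by (simp only: card.empty)
qed

lemma random_vars_support:
  assumes "K \<le> n"
  shows "finite {xs. length xs = K \<and> distinct xs \<and> set xs \<subseteq> {1..n}}"
    and "{xs. length xs = K \<and> distinct xs \<and> set xs \<subseteq> {1..n}} \<noteq> {}"
proof -
  show "finite {xs. length xs = K \<and> distinct xs \<and> set xs \<subseteq> {1..n}}"
    by (rule finite_distinct_lists) simp
  have "[1..<Suc K] \<in> {xs. length xs = K \<and> distinct xs \<and> set xs \<subseteq> {1..n}}"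
    using assms by auto
  then show "{xs. length xs = K \<and> distinct xs \<and> set xs \<subseteq> {1..n}} \<noteq> {}" by blast
qed

lemma set_pmf_random_vars:
  "K \<le> n \<Longrightarrow> set_pmf (random_vars K n) = {xs. length xs = K \<and> distinct xs \<and> set xs \<subseteq> {1..n}}"
  unfolding random_vars_def by (rule set_pmf_of_set) (rule random_vars_support, assumption)+

text \<open>The probability is a quotient of falling factorials with factors (s - i)/(n - i). Each
  is at most s/n because s \<le> n: removing points from both counts can only lower the
  fraction.\<close>

lemma prob_random_vars_subset:
  assumes "K \<le> n"
  shows "measure_pmf.prob (random_vars K n) {xs. set xs \<subseteq> S}
    \<le> (real (card (S \<inter> {1..n})) / real n) ^ K"
proof -
  let ?L = "\<lambda>A. {xs. length xs = K \<and> distinct xs \<and> set xs \<subseteq> A}"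
  let ?s = "card (S \<inter> {1..n})"
  have sn: "?s \<le> n"
    using card_mono[of "{1..n}" "S \<inter> {1..n}"] by simp
  have "measure_pmf.prob (random_vars K n) {xs. set xs \<subseteq> S} =
      real (card (?L {1..n} \<inter> {xs. set xs \<subseteq> S})) / real (card (?L {1..n}))"
    unfolding random_vars_def by (rule measure_pmf_of_set) (rule random_vars_support[OF assms])+
  also have "?L {1..n} \<inter> {xs. set xs \<subseteq> S} = ?L (S \<inter> {1..n})" by auto
  also have "real (card (?L (S \<inter> {1..n}))) / real (card (?L {1..n})) =
      (\<Prod>i<K. real (?s - i) / real (n - i))"
    using card_distinct_lists_eq_prod[of "S \<inter> {1..n}" K] card_distinct_lists_eq_prod[of "{1..n}" K]
    by (simp only: finite_Int finite_atLeastAtMost card_atLeastAtMost prod_dividef of_nat_prod) simp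
  also have "\<dots> \<le> (\<Prod>i<K. real ?s / real n)"
  proof (intro prod_mono conjI)
    fix i assume "i \<in> {..<K}"
    then have i: "i < n" using assms by simp
    show "0 \<le> real (?s - i) / real (n - i)" by simp
    show "real (?s - i) / real (n - i) \<le> real ?s / real n"
    proof (cases "i \<le> ?s")
      case True
      have "real i * real ?s \<le> real i * real n" using sn by (intro mult_left_mono) auto
      then show ?thesis using i True by (simp add: field_simps of_nat_diff)
    qed auto
  qed
  finally show ?thesis by simp
qed

section \<open>Violation probabilities of a random clause\<close>

lemma prob_clause_violate:
  assumes "1 \<le> K" "K \<le> n"
  shows "measure_pmf.prob (random_clause K n) {C. \<not> nae_satisfies \<sigma> [C]} = 2 * (1/2) ^ K"
proof -
  have "measure_pmf.prob (random_clause K n) {C. \<not> nae_satisfies \<sigma> [C]} =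
      measure_pmf.expectation (random_vars K n) (\<lambda>_. 2 * (1/2) ^ K)"
    unfolding random_clause_eq_bind prob_bind_pmf
    by (intro integral_cong_AE AE_pmfI prob_signs_violate[OF assms(1)])
       (simp_all add: set_pmf_random_vars[OF assms(2)])
  then show ?thesis by simp
qed

text \<open>Averages \<open>prob_signs_violate_both\<close> over the variables. The two indicators
  become the probabilities that all K variables fall in the agreement set, of density 1 - h, or in
  the disagreement set, of density h.\<close>

lemma prob_clause_violate_both:
  fixes \<sigma> \<tau> :: assignment
  assumes "1 \<le> K" "K \<le> n"
  defines "h \<equiv> real (hamming n \<sigma> \<tau>) / real n"
  shows "measure_pmf.prob (random_clause K n)
      {C. \<not> nae_satisfies \<sigma> [C] \<and> \<not> nae_satisfies \<tau> [C]}
    \<le> 2 * (1/2) ^ K * ((1 - h) ^ K + h ^ K)"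
proof -
  let ?eq = "{i. \<sigma> i = \<tau> i}" and ?ne = "{i. \<sigma> i \<noteq> \<tau> i}"
  let ?f = "\<lambda>xs. 2 * (1/2) ^ K * (indicator {xs. set xs \<subseteq> ?eq} xs + indicator {xs. set xs \<subseteq> ?ne} xs) :: real"
  have ne: "card (?ne \<inter> {1..n}) = hamming n \<sigma> \<tau>"
    unfolding hamming_def by (rule arg_cong[of _ _ card]) auto
  have "?eq \<inter> {1..n} \<union> ?ne \<inter> {1..n} = {1..n}" by auto
  then have "card (?eq \<inter> {1..n}) + card (?ne \<inter> {1..n}) = card {1..n}"
    by (subst card_Un_disjoint[symmetric]) auto
  then have "real (card (?eq \<inter> {1..n})) = real n - real (hamming n \<sigma> \<tau>)"
    using ne by (simp flip: of_nat_add)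
  then have eq: "real (card (?eq \<inter> {1..n})) / real n = 1 - h"
    using assms by (simp add: field_simps)
  have int: "integrable (measure_pmf (random_vars K n)) (indicator A :: _ \<Rightarrow> real)" for A
    by (rule measure_pmf.integrable_const_bound[where B=1]) auto
  have "measure_pmf.prob (random_clause K n) {C. \<not> nae_satisfies \<sigma> [C] \<and> \<not> nae_satisfies \<tau> [C]} \<le>
      measure_pmf.expectation (random_vars K n) ?f"
    unfolding random_clause_eq_bind prob_bind_pmf
  proof (intro integral_mono_AE AE_pmfI prob_signs_violate_both[OF assms(1)])
    show "integrable (measure_pmf (random_vars K n)) ?f"
      using int by auto
  qed (auto intro!: measure_pmf.integrable_const_bound[where B=1]
        simp: set_pmf_random_vars[OF assms(2)])
  also have "\<dots> = 2 * (1/2) ^ K * (measure_pmf.prob (random_vars K n) {xs. set xs \<subseteq> ?eq} +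
      measure_pmf.prob (random_vars K n) {xs. set xs \<subseteq> ?ne})"
    using int by simp
  also have "\<dots> \<le> 2 * (1/2) ^ K * ((1 - h) ^ K + h ^ K)"
    using prob_random_vars_subset[OF assms(2), of ?eq] prob_random_vars_subset[OF assms(2), of ?ne]
    unfolding eq ne h_def[symmetric]
    by (intro mult_left_mono add_mono) auto
  finally show ?thesis .
qed

text \<open>Second Bonferroni inequality. A new event adds its own probability minus its overlap
  with the earlier union, and the union bound controls that overlap. Grouping pairs by their larger
  index suits both this induction and the termwise estimate in
  \<open>prob_clause_satisfied_all_le\<close>.\<close>

lemma (in prob_space) prob_UN_ge_sum_minus_pairs:
  fixes A :: "nat \<Rightarrow> 'a set"
  assumes [measurable]: "\<And>i. i < m \<Longrightarrow> A i \<in> events"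
  shows "(\<Sum>j<m. prob (A j) - (\<Sum>i<j. prob (A i \<inter> A j))) \<le> prob (\<Union>j<m. A j)"
  using assms
proof (induction m)
  case (Suc m)
  have ev: "\<And>i. i \<le> m \<Longrightarrow> A i \<in> events" using Suc.prems by auto
  then have U: "(\<Union>i<m. A i) \<in> events" by auto
  have "(\<Union>i<m. A i) \<inter> A m = (\<Union>i<m. A i \<inter> A m)" by auto
  also have "prob \<dots> \<le> (\<Sum>i<m. prob (A i \<inter> A m))"
    using ev by (intro finite_measure_subadditive_finite) auto
  finally have *: "prob ((\<Union>i<m. A i) \<inter> A m) \<le> (\<Sum>i<m. prob (A i \<inter> A m))" .
  have "prob (\<Union>j<Suc m. A j) = prob ((\<Union>i<m. A i) \<union> A m)"
    by (simp add: lessThan_Suc Un_commute)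
  also have "\<dots> = prob (\<Union>i<m. A i) + prob (A m) - prob ((\<Union>i<m. A i) \<inter> A m)"
    using U ev[of m] by (simp add: measure_Un3 fmeasurable_eq_sets)
  finally show ?case
    using Suc.IH ev * by simp
qed simp

section \<open>Counting tuples of nearby assignments\<close>

lemma finite_assignments: "finite (assignments n)"
  unfolding assignments_def by (intro finite_PiE) auto

lemma card_assignments: "card (assignments n) = 2 ^ n"
  unfolding assignments_def by (simp add: card_PiE)

text \<open>Generating function of the Hamming distance. The weight is a product over coordinates,
  so the sum factorises, each coordinate contributing 1 for agreement and x for
  disagreement.\<close>

lemma sum_power_hamming:
  fixes x :: real
  shows "(\<Sum>\<tau>\<in>assignments n. x ^ hamming n \<sigma> \<tau>) = (1 + x) ^ n"
proof -
  have "x ^ hamming n \<sigma> \<tau> = (\<Prod>i\<in>{1..n}. if \<sigma> i \<noteq> \<tau> i then x else 1)" for \<tau>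
    unfolding hamming_def by (simp add: prod.If_cases Int_def)
  then have "(\<Sum>\<tau>\<in>assignments n. x ^ hamming n \<sigma> \<tau>) =
      (\<Prod>i\<in>{1..n}. \<Sum>b\<in>UNIV. if \<sigma> i \<noteq> b then x else 1)"
    unfolding assignments_def by (simp add: prod_sum_PiE)
  moreover have "(\<Sum>b\<in>UNIV. if s \<noteq> b then x else 1) = 1 + x" for s :: bool
    by (cases s) (auto simp: UNIV_bool)
  ultimately show ?thesis by simp
qed

text \<open>Chernoff-type weighting: since x \<le> 1, every point of the ball has weight at least
  \<open>x powr r\<close> in the generating function.\<close>

lemma card_hamming_ball_le:
  assumes "0 < x" "x \<le> 1"
  shows "real (card {\<tau> \<in> assignments n. real (hamming n \<sigma> \<tau>) \<le> r}) \<le> (1 + x) ^ n * x powr (- r)"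
proof -
  let ?B = "{\<tau> \<in> assignments n. real (hamming n \<sigma> \<tau>) \<le> r}"
  have "real (card ?B) * x powr r = (\<Sum>\<tau>\<in>?B. x powr r)" by simp
  also have "\<dots> \<le> (\<Sum>\<tau>\<in>?B. x ^ hamming n \<sigma> \<tau>)"
    using assms by (intro sum_mono) (auto simp: powr_realpow[symmetric] intro: powr_mono')
  also have "\<dots> \<le> (\<Sum>\<tau>\<in>assignments n. x ^ hamming n \<sigma> \<tau>)"
    using assms finite_assignments by (intro sum_mono2) auto
  also have "\<dots> = (1 + x) ^ n" by (rule sum_power_hamming)
  finally show ?thesis
    using assms by (simp add: powr_minus field_simps)
qed

text \<open>Keeps only the distances from the first component, so that the other \<open>k\<close>
  components can be counted independently in one Hamming ball.\<close>

definition near_tuples :: "nat \<Rightarrow> real \<Rightarrow> nat \<Rightarrow> assignment list set" where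
  "near_tuples n r k = {\<sigma>s. length \<sigma>s = Suc k \<and> set \<sigma>s \<subseteq> assignments n \<and>
     (\<forall>\<tau>\<in>set (tl \<sigma>s). real (hamming n (hd \<sigma>s) \<tau>) \<le> r)}"

lemma finite_near_tuples: "finite (near_tuples n r k)"
  unfolding near_tuples_def
  by (rule finite_subset[OF _ finite_lists_length_eq[OF finite_assignments[of n], of "Suc k"]]) auto

lemma card_near_tuples_le:
  assumes "0 < x" "x \<le> 1"
  shows "real (card (near_tuples n r k)) \<le> 2 ^ n * ((1 + x) ^ n * x powr (- r)) ^ k"
proof -
  let ?B = "\<lambda>\<sigma>. {\<tau> \<in> assignments n. real (hamming n \<sigma> \<tau>) \<le> r}"
  let ?S = "SIGMA \<sigma>:assignments n. {\<tau>s. set \<tau>s \<subseteq> ?B \<sigma> \<and> length \<tau>s = k}"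
  have fin: "finite (?B \<sigma>)" for \<sigma> using finite_assignments by simp
  have "near_tuples n r k \<subseteq> (\<lambda>(\<sigma>, \<tau>s). \<sigma> # \<tau>s) ` ?S"
    by (auto simp: near_tuples_def length_Suc_conv image_iff)
  moreover have finS: "finite ?S"
    using finite_assignments fin by (intro finite_SigmaI finite_lists_length_eq)
  ultimately have "card (near_tuples n r k) \<le> card ?S"
    by (meson card_image_le card_mono finite_imageI order_trans)
  also have "card ?S = (\<Sum>\<sigma>\<in>assignments n. card (?B \<sigma>) ^ k)"
    using finite_assignments fin
    by (simp add: card_lists_length_eq finite_lists_length_eq del: mem_Collect_eq)
  finally have "real (card (near_tuples n r k)) \<le> (\<Sum>\<sigma>\<in>assignments n. real (card (?B \<sigma>)) ^ k)"
    by (simp flip: of_nat_power of_nat_sum)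
  also have "\<dots> \<le> (\<Sum>\<sigma>\<in>assignments n. ((1 + x) ^ n * x powr (- r)) ^ k)"
    using card_hamming_ball_le[OF assms] by (intro sum_mono power_mono) auto
  finally show ?thesis
    by (simp add: card_assignments)
qed

section \<open>The first moment bound\<close>

text \<open>By Bonferroni the violation events cover probability at least p m (1 - \<delta>) with p
  = 2 (1/2)^K: every component contributes p and loses at most p \<delta> to overlaps. The
  exponential comes from 1 - x \<le> exp (-x).\<close>

lemma prob_clause_satisfied_all_le:
  assumes K: "1 \<le> K" "K \<le> n" and \<alpha>: "\<alpha> \<le> 1" and \<beta>: "0 \<le> \<beta>"
    and dist: "\<And>i j. i < m \<Longrightarrow> j < m \<Longrightarrow> i \<noteq> j \<Longrightarrow>
      \<alpha> * real n \<le> real (hamming n (\<sigma>s ! i) (\<sigma>s ! j)) \<and>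
      real (hamming n (\<sigma>s ! i) (\<sigma>s ! j)) \<le> \<beta> * real n"
    and q: "real m * ((1 - \<alpha>) ^ K + \<beta> ^ K) \<le> \<delta>"
  shows "measure_pmf.prob (random_clause K n) {C. \<forall>j<m. nae_satisfies (\<sigma>s ! j) [C]}
    \<le> exp (- (2 * (1/2) ^ K * real m * (1 - \<delta>)))"
proof -
  let ?M = "random_clause K n" and ?p = "2 * (1/2) ^ K :: real"
  let ?q = "(1 - \<alpha>) ^ K + \<beta> ^ K"
  define A where "A = (\<lambda>j. {C. \<not> nae_satisfies (\<sigma>s ! j) [C]})"
  have n: "0 < real n" using K by simp
  have pair: "measure_pmf.prob ?M (A i \<inter> A j) \<le> ?p * ?q" if "i < j" "j < m" for i j
  proof -
    let ?h = "real (hamming n (\<sigma>s ! i) (\<sigma>s ! j)) / real n"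
    have h: "\<alpha> \<le> ?h" "?h \<le> \<beta>"
      using dist[of i j] that n by (auto simp: field_simps)
    \<comment> \<open>Makes \<open>1 - ?h\<close> nonnegative, as monotonicity of powers
      requires.\<close>
    have "hamming n (\<sigma>s ! i) (\<sigma>s ! j) \<le> n"
      unfolding hamming_def by (rule order_trans[OF card_mono[of "{1..n}"]]) auto
    then have "?h \<le> 1" using n by simp
    have "measure_pmf.prob ?M (A i \<inter> A j) \<le> ?p * ((1 - ?h) ^ K + ?h ^ K)"
      using prob_clause_violate_both[OF K, of "\<sigma>s ! i" "\<sigma>s ! j"]
      by (simp add: A_def Collect_conj_eq)
    also have "\<dots> \<le> ?p * ?q"
      using h \<open>?h \<le> 1\<close> by (intro mult_left_mono add_mono power_mono) auto
    finally show ?thesis .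
  qed
  have "?p * real m * (1 - \<delta>) = (\<Sum>j<m. ?p - ?p * \<delta>)"
    by (simp add: algebra_simps)
  also have "\<dots> \<le> (\<Sum>j<m. measure_pmf.prob ?M (A j) - (\<Sum>i<j. measure_pmf.prob ?M (A i \<inter> A j)))"
  proof (intro sum_mono)
    fix j assume j: "j \<in> {..<m}"
    show "?p - ?p * \<delta> \<le> measure_pmf.prob ?M (A j) - (\<Sum>i<j. measure_pmf.prob ?M (A i \<inter> A j))"
    proof -
      have "(\<Sum>i<j. measure_pmf.prob ?M (A i \<inter> A j)) \<le> (\<Sum>i<j. ?p * ?q)"
        using j by (intro sum_mono pair) auto
      also have "\<dots> = real j * (?p * ?q)" by simp
      also have "\<dots> \<le> real m * (?p * ?q)"
        using j \<alpha> \<beta> by (intro mult_right_mono) auto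
      also have "\<dots> = ?p * (real m * ?q)" by (simp add: algebra_simps)
      also have "\<dots> \<le> ?p * \<delta>" using q by (intro mult_left_mono) auto
      finally show ?thesis
        using prob_clause_violate[OF K, of "\<sigma>s ! j"] by (simp add: A_def)
    qed
  qed
  also have "\<dots> \<le> measure_pmf.prob ?M (\<Union>j<m. A j)"
    by (rule measure_pmf.prob_UN_ge_sum_minus_pairs) auto
  also have "\<dots> = 1 - measure_pmf.prob ?M {C. \<forall>j<m. nae_satisfies (\<sigma>s ! j) [C]}"
    by (subst measure_pmf.prob_compl[symmetric]) (auto simp: A_def intro!: arg_cong[of _ _ "measure_pmf.prob ?M"])
  finally show ?thesis
    using exp_ge_add_one_self[of "- (?p * real m * (1 - \<delta>))"] by linarith
qed

text \<open>Union bound over a finite set of candidate tuples that does not depend on the formula.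
  The exponent is the logarithm of the count bound minus the cost of all clauses.\<close>

lemma prob_SAT_tuples_nonempty_le:
  assumes K: "1 \<le> K" "K \<le> n" and \<eta>: "0 \<le> \<eta>" and \<beta>: "0 < \<beta>" "\<beta> \<le> 1"
    and q: "real (Suc k) * ((1 - (\<beta> - \<eta>)) ^ K + \<beta> ^ K) \<le> \<delta>"
  shows "measure_pmf.prob (random_formula K n d) {\<Phi>. SAT_tuples n \<Phi> \<beta> \<eta> (Suc k) \<noteq> {}}
    \<le> exp (real n * (ln 2 + real k * (\<beta> - \<beta> * ln \<beta>))
        - real (nat \<lfloor>d * real n\<rfloor>) * (2 * (1/2) ^ K * real (Suc k) * (1 - \<delta>)))"
proof -
  let ?m = "Suc k" and ?N = "nat \<lfloor>d * real n\<rfloor>" and ?c = "2 * (1/2) ^ K * real (Suc k) * (1 - \<delta>)"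
  \<comment> \<open>All pairwise distances are kept because the clause estimate needs their lower
    bounds; the cardinality is bounded through \<open>near_tuples\<close> alone.\<close>
  define T where "T = {\<sigma>s \<in> near_tuples n (\<beta> * real n) k. \<forall>i<?m. \<forall>j<?m. i \<noteq> j \<longrightarrow>
      (\<beta> - \<eta>) * real n \<le> real (hamming n (\<sigma>s ! i) (\<sigma>s ! j)) \<and>
      real (hamming n (\<sigma>s ! i) (\<sigma>s ! j)) \<le> \<beta> * real n}"
  \<comment> \<open>Phrased clause by clause, so that independence enters through
    \<open>prob_replicate_pmf_all\<close>.\<close>
  define E where "E = (\<lambda>\<sigma>s. {\<Phi>. \<forall>C\<in>set \<Phi>. \<forall>j<?m. nae_satisfies (\<sigma>s ! j) [C]})"
  have fin: "finite T" unfolding T_def using finite_near_tuples by simp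
  have "{\<Phi>. SAT_tuples n \<Phi> \<beta> \<eta> ?m \<noteq> {}} \<subseteq> (\<Union>\<sigma>s\<in>T. E \<sigma>s)"
  proof
    fix \<Phi> assume "\<Phi> \<in> {\<Phi>. SAT_tuples n \<Phi> \<beta> \<eta> ?m \<noteq> {}}"
    then obtain \<sigma>s where \<sigma>s: "\<sigma>s \<in> SAT_tuples n \<Phi> \<beta> \<eta> ?m" by auto
    then obtain \<sigma> \<tau>s where Cons: "\<sigma>s = \<sigma> # \<tau>s" "length \<tau>s = k"
      by (auto simp: SAT_tuples_def length_Suc_conv)
    have dist: "\<forall>i<?m. \<forall>j<?m. i \<noteq> j \<longrightarrow>
      (\<beta> - \<eta>) * real n \<le> real (hamming n (\<sigma>s ! i) (\<sigma>s ! j)) \<and>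
      real (hamming n (\<sigma>s ! i) (\<sigma>s ! j)) \<le> \<beta> * real n" and sub: "set \<sigma>s \<subseteq> assignments n"
      and sat: "\<forall>j<?m. nae_satisfies (\<sigma>s ! j) \<Phi>"
      using \<sigma>s by (auto simp: SAT_tuples_def)
    have "real (hamming n \<sigma> \<tau>) \<le> \<beta> * real n" if "\<tau> \<in> set \<tau>s" for \<tau>
    proof -
      \<comment> \<open>Entry \<open>j\<close> of the tail is entry \<open>Suc j\<close> of the
        tuple.\<close>
      from that obtain j where "j < k" "\<tau>s ! j = \<tau>" using Cons by (auto simp: in_set_conv_nth)
      then show ?thesis using dist[rule_format, of 0 "Suc j"] Cons by simp
    qed
    then have "\<sigma>s \<in> T"
      using Cons sub dist by (simp add: T_def near_tuples_def)
    moreover have "\<Phi> \<in> E \<sigma>s"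
      using sat by (auto simp: E_def nae_satisfies_def)
    ultimately show "\<Phi> \<in> (\<Union>\<sigma>s\<in>T. E \<sigma>s)" by blast
  qed
  then have "measure_pmf.prob (random_formula K n d) {\<Phi>. SAT_tuples n \<Phi> \<beta> \<eta> ?m \<noteq> {}} \<le>
      measure_pmf.prob (random_formula K n d) (\<Union>\<sigma>s\<in>T. E \<sigma>s)"
    by (intro measure_pmf.finite_measure_mono) auto
  also have "\<dots> \<le> (\<Sum>\<sigma>s\<in>T. measure_pmf.prob (random_formula K n d) (E \<sigma>s))"
    using fin by (intro measure_pmf.finite_measure_subadditive_finite) auto
  also have "\<dots> \<le> (\<Sum>\<sigma>s\<in>T. exp (- ?c) ^ ?N)"
  proof (intro sum_mono)
    fix \<sigma>s assume "\<sigma>s \<in> T"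
    then have "measure_pmf.prob (random_clause K n) {C. \<forall>j<?m. nae_satisfies (\<sigma>s ! j) [C]} \<le> exp (- ?c)"
      using K \<eta> \<beta> q
      by (intro prob_clause_satisfied_all_le[where \<alpha>="\<beta> - \<eta>" and \<beta>=\<beta>]) (auto simp: T_def near_tuples_def)
    then show "measure_pmf.prob (random_formula K n d) (E \<sigma>s) \<le> exp (- ?c) ^ ?N"
      unfolding random_formula_def E_def prob_replicate_pmf_all by (intro power_mono) auto
  qed
  also have "\<dots> = real (card T) * exp (- (real ?N * ?c))"
    by (simp add: exp_of_nat_mult[symmetric])
  also have "\<dots> \<le> exp (real n * (ln 2 + real k * (\<beta> - \<beta> * ln \<beta>))) * exp (- (real ?N * ?c))"
  proof (intro mult_right_mono)
    have "real (card T) \<le> real (card (near_tuples n (\<beta> * real n) k))"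
      unfolding T_def using finite_near_tuples by (auto intro!: card_mono)
    \<comment> \<open>The ball bound is used with weight x = \<beta>, close to its optimum
      \<beta>/(1 - \<beta>) for small \<beta>. With 1 + \<beta> \<le> exp \<beta> it yields the
      entropy term \<beta> - \<beta> ln \<beta>.\<close>
    also have "\<dots> \<le> 2 ^ n * ((1 + \<beta>) ^ n * \<beta> powr (- (\<beta> * real n))) ^ k"
      using \<beta> by (rule card_near_tuples_le)
    also have "\<dots> \<le> 2 ^ n * (exp \<beta> ^ n * \<beta> powr (- (\<beta> * real n))) ^ k"
      using \<beta> exp_ge_add_one_self[of \<beta>]
      by (intro mult_left_mono power_mono mult_right_mono) auto
    also have "\<dots> = exp (real n * ln 2) * (exp (real n * \<beta>) * exp (- (\<beta> * real n) * ln \<beta>)) ^ k"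
      using \<beta> by (simp add: exp_of_nat_mult powr_def)
    also have "\<dots> = exp (real n * ln 2 + real k * (real n * \<beta> + - (\<beta> * real n) * ln \<beta>))"
      by (simp only: exp_add exp_of_nat_mult)
    also have "\<dots> = exp (real n * (ln 2 + real k * (\<beta> - \<beta> * ln \<beta>)))"
      by (simp add: algebra_simps)
    finally show "real (card T) \<le> exp (real n * (ln 2 + real k * (\<beta> - \<beta> * ln \<beta>)))" .
  qed simp
  finally show ?thesis
    by (simp only: diff_conv_add_uminus exp_add)
qed

section \<open>Choice of constants and the limit\<close>

theorem theorem4p1:
  fixes \<epsilon> :: real
  assumes "0 < \<epsilon>" and "\<epsilon> < 1"
  shows "\<exists>K0::nat. \<forall>K\<ge>K0. \<forall>d::real. d \<ge> (1 + \<epsilon>) * 2 ^ (K - 1) * (ln (real K))\<^sup>2 / real K \<longrightarrow>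
    (let \<beta> = ln (real K) / real K;
         \<eta> = (ln (real K) / real K)\<^sup>2;
         m = nat \<lceil>\<epsilon>\<^sup>2 * real K / ln (real K)\<rceil>
     in (\<lambda>n. measure_pmf.prob (random_formula K n d) {\<Phi>. SAT_tuples n \<Phi> \<beta> \<eta> m = {}})
          \<longlonglongrightarrow> 1)"
proof -
  \<comment> \<open>Half of the surplus \<epsilon> in the clause density is given up to overlaps;
    the factor 1 + \<epsilon>/2 remains.\<close>
  define \<delta> where "\<delta> = (\<epsilon> / 2) / (1 + \<epsilon>)"
  have \<delta>: "0 < \<delta>" "\<delta> < 1" "(1 + \<epsilon>) * (1 - \<delta>) = 1 + \<epsilon> / 2"
    using assms by (auto simp: \<delta>_def field_simps)
  \<comment> \<open>The first factor bounds \<open>m\<close>, as \<epsilon> < 1. The second behaves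
    like 1/K, so the product decays like 1/ln K.\<close>
  have "((\<lambda>K::nat. (real K / ln (real K) + 1) *
      ((1 - (ln (real K) / real K - (ln (real K) / real K)\<^sup>2)) powr real K + (ln (real K) / real K) powr real K))
      \<longlongrightarrow> 0) sequentially"
    by real_asymp
  then have ev_q: "\<forall>\<^sub>F K::nat in sequentially. (real K / ln (real K) + 1) *
      ((1 - (ln (real K) / real K - (ln (real K) / real K)\<^sup>2)) powr real K + (ln (real K) / real K) powr real K) < \<delta>"
    using \<delta> by (auto dest: order_tendstoD)
  have "filterlim (\<lambda>K::nat. ln (real K)) at_top sequentially" by real_asymp
  \<comment> \<open>Equivalent to \<open>\<gamma> > 0\<close> below: the gain (\<epsilon>^3/2) ln K
    must beat ln 2, the cost of choosing the first component.\<close>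
  then have ev_ln: "\<forall>\<^sub>F K::nat in sequentially. ln (real K) > ln 2 / (\<epsilon>^3 / 2)"
    by (auto simp: filterlim_at_top_dense)
  \<comment> \<open>Later absorbs the 1 in 1 + L - ln L.\<close>
  have ev_lnln: "\<forall>\<^sub>F K::nat in sequentially. ln (ln (real K)) \<ge> 1" by real_asymp
  have ev_pos: "\<forall>\<^sub>F K::nat in sequentially. ln (real K) > 0" by real_asymp
  have ev_beta: "\<forall>\<^sub>F K::nat in sequentially. ln (real K) / real K < 1" by real_asymp
  have "\<forall>\<^sub>F K::nat in sequentially. \<forall>d::real. d \<ge> (1 + \<epsilon>) * 2 ^ (K - 1) * (ln (real K))\<^sup>2 / real K \<longrightarrow>
    (let \<beta> = ln (real K) / real K;
         \<eta> = (ln (real K) / real K)\<^sup>2;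
         m = nat \<lceil>\<epsilon>\<^sup>2 * real K / ln (real K)\<rceil>
     in (\<lambda>n. measure_pmf.prob (random_formula K n d) {\<Phi>. SAT_tuples n \<Phi> \<beta> \<eta> m = {}})
          \<longlonglongrightarrow> 1)"
    using ev_q ev_ln ev_lnln ev_pos ev_beta
  proof eventually_elim
    case (elim K)
    define L where "L = ln (real K)"
    define \<beta> where "\<beta> = L / real K"
    define m where "m = nat \<lceil>\<epsilon>\<^sup>2 * real K / L\<rceil>"
    define k where "k = m - 1"
    have L: "L > 0" "ln L \<ge> 1" "ln 2 < \<epsilon>^3 / 2 * L"
      using elim assms by (auto simp: L_def field_simps)
    \<comment> \<open>By convention \<open>ln 0 = 0\<close>, so a positive logarithm rules out
      \<open>K = 0\<close>.\<close>
    have K: "K \<ge> 1" using elim(4) by (cases K) auto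
    have \<beta>: "0 < \<beta>" "\<beta> < 1" using L K elim(5) by (auto simp: \<beta>_def L_def)
    have m_pos: "0 < \<epsilon>\<^sup>2 * real K / L" using L K assms by auto
    \<comment> \<open>Rounding up helps on both sides: the violation exponent uses \<open>m\<close>,
      bounded below, while the count of ball points uses \<open>k\<close>, bounded above by the same
      quantity.\<close>
    then have m: "m = Suc k" "\<epsilon>\<^sup>2 * real K / L \<le> real m" "real k \<le> \<epsilon>\<^sup>2 * real K / L"
      unfolding k_def m_def by linarith+
    have "\<epsilon>\<^sup>2 \<le> 1" using assms by (simp add: power_le_one)
    then have "\<epsilon>\<^sup>2 * real K / L \<le> real K / L"
      using L by (intro divide_right_mono) (auto simp: mult_left_le_one_le)
    then have m_le: "real m \<le> real K / L + 1" using m by simp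
    have base: "0 < 1 - (\<beta> - \<beta>\<^sup>2)"
      using \<beta> zero_le_power2[of \<beta>] by linarith
    have pow: "(1 - (\<beta> - \<beta>\<^sup>2)) powr real K = (1 - (\<beta> - \<beta>\<^sup>2)) ^ K" "\<beta> powr real K = \<beta> ^ K"
      using base \<beta> by (simp_all only: powr_realpow)
    have "real m * ((1 - (\<beta> - \<beta>\<^sup>2)) ^ K + \<beta> ^ K) \<le> (real K / L + 1) * ((1 - (\<beta> - \<beta>\<^sup>2)) ^ K + \<beta> ^ K)"
      using m_le base \<beta> by (intro mult_right_mono add_nonneg_nonneg zero_le_power) auto
    also have "\<dots> \<le> \<delta>"
      using elim(1) unfolding L_def[symmetric] \<beta>_def[symmetric] pow by simp
    finally have q: "real m * ((1 - (\<beta> - \<beta>\<^sup>2)) ^ K + \<beta> ^ K) \<le> \<delta>" .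

    \<comment> \<open>Here ln \<beta> = ln L - L.\<close>
    have "\<beta> - \<beta> * ln \<beta> = \<beta> * (1 + L - ln L)"
      using L K by (simp add: \<beta>_def ln_div L_def[symmetric] algebra_simps
          add_divide_distrib diff_divide_distrib)
    also have "\<dots> \<le> \<beta> * L" using L \<beta> by (intro mult_left_mono) auto
    finally have "real k * (\<beta> - \<beta> * ln \<beta>) \<le> real k * (\<beta> * L)" by (intro mult_left_mono) auto
    also have "\<dots> \<le> (\<epsilon>\<^sup>2 * real K / L) * (\<beta> * L)" using m L \<beta> by (intro mult_right_mono) auto
    also have "\<dots> = \<epsilon>\<^sup>2 * L" using L K by (simp add: \<beta>_def)
    finally have entropy: "real k * (\<beta> - \<beta> * ln \<beta>) \<le> \<epsilon>\<^sup>2 * L" .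

    have "(\<lambda>n. measure_pmf.prob (random_formula K n d) {\<Phi>. SAT_tuples n \<Phi> \<beta> (\<beta>\<^sup>2) m = {}}) \<longlonglongrightarrow> 1"
      if d: "d \<ge> (1 + \<epsilon>) * 2 ^ (K - 1) * L\<^sup>2 / real K" for d
    proof -
      define p :: real where "p = 2 * (1/2) ^ K"
      define c where "c = p * real m * (1 - \<delta>)"
      have p: "p > 0" "p * 2 ^ (K - 1) = 1"
        using K by (auto simp: p_def power_one_over power_diff)
      have c: "0 \<le> c" using p \<delta> by (simp add: c_def)
      \<comment> \<open>Up to rounding, c d is the clause cost per variable. The lower bounds on
        \<open>m\<close> and \<open>d\<close> are inserted, and p cancels the scale 2^(K-1) of the
        density.\<close>
      have "(1 + \<epsilon> / 2) * (\<epsilon>\<^sup>2 * L) = (1 + \<epsilon>) * (1 - \<delta>) * (L\<^sup>2 / real K) * (\<epsilon>\<^sup>2 * real K / L)"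
        unfolding \<delta>(3) using L K by (simp add: power2_eq_square)
      also have "\<dots> \<le> (1 + \<epsilon>) * (1 - \<delta>) * (L\<^sup>2 / real K) * real m"
        using m \<delta> assms by (intro mult_left_mono) auto
      also have "\<dots> = (p * 2 ^ (K - 1)) * ((1 + \<epsilon>) * (1 - \<delta>) * (L\<^sup>2 / real K) * real m)"
        using p by simp
      also have "\<dots> = c * ((1 + \<epsilon>) * 2 ^ (K - 1) * L\<^sup>2 / real K)"
        by (simp add: c_def)
      also have "\<dots> \<le> c * d" using d c by (rule mult_left_mono)
      finally have cd: "(1 + \<epsilon> / 2) * (\<epsilon>\<^sup>2 * L) \<le> c * d" .
      \<comment> \<open>Net decay rate per variable: clause cost (1 + \<epsilon>/2) \<epsilon>^2 L
        minus the tuple count exponent ln 2 + \<epsilon>^2 L.\<close>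
      define \<gamma> where "\<gamma> = \<epsilon>^3 / 2 * L - ln 2"
      have \<gamma>: "\<gamma> > 0" using L by (simp add: \<gamma>_def)
      \<comment> \<open>Taking n \<ge> K avoids the range where sampling is unspecified, at no loss
        in the limit.\<close>
      have bound: "measure_pmf.prob (random_formula K n d) {\<Phi>. SAT_tuples n \<Phi> \<beta> (\<beta>\<^sup>2) m \<noteq> {}} \<le> exp (c - \<gamma> * real n)"
        if "n \<ge> K" for n
      proof -
        have "measure_pmf.prob (random_formula K n d) {\<Phi>. SAT_tuples n \<Phi> \<beta> (\<beta>\<^sup>2) m \<noteq> {}} \<le>
          exp (real n * (ln 2 + real k * (\<beta> - \<beta> * ln \<beta>)) - real (nat \<lfloor>d * real n\<rfloor>) * c)"
          using prob_SAT_tuples_nonempty_le[OF K that, of "\<beta>\<^sup>2" \<beta> k \<delta> d] \<beta> q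
          by (simp add: m c_def p_def)
        also have "\<dots> \<le> exp (c - \<gamma> * real n)"
        proof -
          \<comment> \<open>Rounding down loses at most one clause, which costs only the factor
            \<open>exp c\<close>, independent of n.\<close>
          have "d * real n - 1 \<le> real (nat \<lfloor>d * real n\<rfloor>)" by linarith
          from mult_left_mono[OF this c]
          have "c * d * real n - c \<le> real (nat \<lfloor>d * real n\<rfloor>) * c"
            by (simp add: algebra_simps)
          moreover have "(1 + \<epsilon> / 2) * (\<epsilon>\<^sup>2 * L) * real n \<le> c * d * real n"
            using cd by (intro mult_right_mono) auto
          moreover have "real n * (ln 2 + real k * (\<beta> - \<beta> * ln \<beta>)) \<le> real n * (ln 2 + \<epsilon>\<^sup>2 * L)"
            using entropy by (intro mult_left_mono) auto
          moreover have "real n * (ln 2 + \<epsilon>\<^sup>2 * L) - (1 + \<epsilon> / 2) * (\<epsilon>\<^sup>2 * L) * real n = - \<gamma> * real n"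
            by (simp add: \<gamma>_def algebra_simps power2_eq_square power3_eq_cube)
          ultimately show ?thesis by simp
        qed
        finally show ?thesis .
      qed
      have compl: "measure_pmf.prob M {\<Phi>. SAT_tuples n \<Phi> \<beta> (\<beta>\<^sup>2) m = {}} =
          1 - measure_pmf.prob M {\<Phi>. SAT_tuples n \<Phi> \<beta> (\<beta>\<^sup>2) m \<noteq> {}}" for M n
        using measure_pmf.prob_neg[of M "\<lambda>\<Phi>. SAT_tuples n \<Phi> \<beta> (\<beta>\<^sup>2) m \<noteq> {}"] by simp
      show ?thesis
      proof (rule tendsto_sandwich[of "\<lambda>n. 1 - exp (c - \<gamma> * real n)" _ _ "\<lambda>_. 1"])
        show "\<forall>\<^sub>F n in sequentially. 1 - exp (c - \<gamma> * real n) \<le>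
            measure_pmf.prob (random_formula K n d) {\<Phi>. SAT_tuples n \<Phi> \<beta> (\<beta>\<^sup>2) m = {}}"
          using eventually_ge_at_top[of K] by eventually_elim (use bound in \<open>simp add: compl\<close>)
        show "(\<lambda>n. 1 - exp (c - \<gamma> * real n)) \<longlonglongrightarrow> 1"
          using \<gamma> by real_asymp
      qed auto
    qed
    then show ?case
      by (simp add: Let_def L_def \<beta>_def m_def)
  qed
  then show ?thesis
    by (simp add: eventually_sequentially)
qed

end
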